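(* Let $k$ be a field and suppose that a finite group $G$ acts on the $n$-dimensional $k$-vector space $V:=k^n$ by permuting the coordinates, so that $G$ acts on $k[V]=k[x_1,\dots,x_n]$ by permuting the variables. Let $\mathcal{O}_1,\dots,\mathcal{O}_r$ be the orbits for the action of $G$ on $\{x_1,\dots,x_n\}$, and let $n_i=|\mathcal{O}_i|$ for $i=1,\dots,r$. Then $$D_{\mathrm{span}}(G,V)\leq \operatorname{topdeg}(G,V)\leq \sum_{i=1}^r \binom{n_i}{2}\leq \binom{n}{2}.$$
   Context: $k[V]$ is the ring of polynomial functions on $V$, with $G$-action $(gf)(v)=f(g^{-1}v)$; $k(V)$ is its fraction field; $k[V]^G$ and $k(V)^G$ are the $G$-invariants; $k[V]_{\le d}$ is the space of polynomials of degree at most $d$. All minima are over $d\in\mathbb{N}=\{0,1,2,\dots\}$. $\operatorname{topdeg}(G,V)$ is the minimum $d$ such that $k[V]_{\le d}$ generates $k[V]$ as a module over $k[V]^G$. $D_{\mathrm{span}}(G,V)$ is the minimum $d$ such that $k[V]_{\le d}$ spans $k(V)$ as a $k(V)^G$-vector space. *)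

theory Defs
  imports
    "HOL-Library.Poly_Mapping"
    "HOL-Computational_Algebra.Fraction_Field"
    "HOL-Algebra.Group_Action"
begin

section \<open>Polynomials in \<open>x\<^sub>1, \<dots>, x\<^sub>n\<close>\<close>

text \<open>
  A monomial is its exponent vector. The type below has a variable for every natural number;
  \<open>k[V] = k[x\<^sub>1, \<dots>, x\<^sub>n]\<close> is the subring \<open>polys n\<close> of the polynomials in which only the variables
  with index in \<open>{1..n}\<close> occur.
\<close>

type_synonym 'k mpoly = "(nat \<Rightarrow>\<^sub>0 nat) \<Rightarrow>\<^sub>0 'k"

definition Var :: "nat \<Rightarrow> 'k::comm_ring_1 mpoly"
  where "Var i = Poly_Mapping.single (Poly_Mapping.single i 1) 1"

definition Const :: "'k::comm_ring_1 \<Rightarrow> 'k mpoly"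
  where "Const c = Poly_Mapping.single 0 c"

definition polys :: "nat \<Rightarrow> 'k::comm_ring_1 mpoly set"
  where "polys n = {f. \<forall>m\<in>Poly_Mapping.keys f. Poly_Mapping.keys m \<subseteq> {1..n}}"

definition polys_le :: "nat \<Rightarrow> nat \<Rightarrow> 'k::comm_ring_1 mpoly set"
  where "polys_le n d =
    {f \<in> polys n. \<forall>m\<in>Poly_Mapping.keys f. (\<Sum>i\<in>Poly_Mapping.keys m. Poly_Mapping.lookup m i) \<le> d}"

text \<open>Substitution of the polynomial \<open>s i\<close> for \<open>x\<^sub>i\<close>.\<close>

definition poly_subst :: "(nat \<Rightarrow> 'k::comm_ring_1 mpoly) \<Rightarrow> 'k mpoly \<Rightarrow> 'k mpoly"
  where "poly_subst s f =
    (\<Sum>m\<in>Poly_Mapping.keys f.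
       Const (Poly_Mapping.lookup f m) * (\<Prod>i\<in>Poly_Mapping.keys m. s i ^ Poly_Mapping.lookup m i))"

definition ratfuns :: "nat \<Rightarrow> 'k::field mpoly fract set"
  where "ratfuns n = {Fract a b | a b. a \<in> polys n \<and> b \<in> polys n \<and> b \<noteq> 0}"


section \<open>Linear actions and invariants\<close>

text \<open>
  A linear action of \<open>G\<close> on \<open>V = k\<^sup>n\<close> is given by its matrices \<open>R g\<close>, with entries \<open>R g i j\<close> for
  \<open>i, j \<in> {1..n}\<close>, so that \<open>(g v)\<^sub>i = (\<Sum>j=1..n. R g i j * v\<^sub>j)\<close>.
  Hence \<open>(g f)(v) = f(g\<^sup>-\<^sup>1 v)\<close> is obtained by substituting for \<open>x\<^sub>i\<close> the \<open>i\<close>-th coordinate of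
  \<open>g\<^sup>-\<^sup>1\<close> applied to \<open>(x\<^sub>1, \<dots>, x\<^sub>n)\<close>.
\<close>

definition poly_act ::
  "('g, 'b) monoid_scheme \<Rightarrow> nat \<Rightarrow> ('g \<Rightarrow> nat \<Rightarrow> nat \<Rightarrow> 'k::comm_ring_1) \<Rightarrow> 'g \<Rightarrow> 'k mpoly \<Rightarrow> 'k mpoly"
  where "poly_act G n R g = poly_subst (\<lambda>i. \<Sum>j=1..n. Const (R (inv\<^bsub>G\<^esub> g) i j) * Var j)"

text \<open>The induced action on fractions, \<open>g (a / b) = (g a) / (g b)\<close>.\<close>

definition rat_act ::
  "('g, 'b) monoid_scheme \<Rightarrow> nat \<Rightarrow> ('g \<Rightarrow> nat \<Rightarrow> nat \<Rightarrow> 'k::field) \<Rightarrow> 'g \<Rightarrow> 'k mpoly fract \<Rightarrow> 'k mpoly fract"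
  where "rat_act G n R g q =
    (THE r. \<exists>a b. a \<in> polys n \<and> b \<in> polys n \<and> b \<noteq> 0 \<and> q = Fract a b \<and>
                  r = Fract (poly_act G n R g a) (poly_act G n R g b))"

definition poly_invs ::
  "('g, 'b) monoid_scheme \<Rightarrow> nat \<Rightarrow> ('g \<Rightarrow> nat \<Rightarrow> nat \<Rightarrow> 'k::comm_ring_1) \<Rightarrow> 'k mpoly set"
  where "poly_invs G n R = {f \<in> polys n. \<forall>g\<in>carrier G. poly_act G n R g f = f}"

definition rat_invs ::
  "('g, 'b) monoid_scheme \<Rightarrow> nat \<Rightarrow> ('g \<Rightarrow> nat \<Rightarrow> nat \<Rightarrow> 'k::field) \<Rightarrow> 'k mpoly fract set"
  where "rat_invs G n R = {q \<in> ratfuns n. \<forall>g\<in>carrier G. rat_act G n R g q = q}"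

text \<open>The description in \<open>rat_act\<close> is unambiguous for every action by injective ring homomorphisms.\<close>

lemma rat_act_Fract:
  assumes mult: "\<And>a b. a \<in> polys n \<Longrightarrow> b \<in> polys n \<Longrightarrow>
                   poly_act G n R g (a * b) = poly_act G n R g a * poly_act G n R g b"
    and nz: "\<And>b. b \<in> polys n \<Longrightarrow> b \<noteq> 0 \<Longrightarrow> poly_act G n R g b \<noteq> 0"
    and ab: "a \<in> polys n" "b \<in> polys n" "b \<noteq> 0"
  shows "rat_act G n R g (Fract a b) = Fract (poly_act G n R g a) (poly_act G n R g b)"
  unfolding rat_act_def
proof (rule the_equality)
  show "\<exists>a' b'. a' \<in> polys n \<and> b' \<in> polys n \<and> b' \<noteq> 0 \<and> Fract a b = Fract a' b' \<and>
          Fract (poly_act G n R g a) (poly_act G n R g b) =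
          Fract (poly_act G n R g a') (poly_act G n R g b')"
    using ab by blast
next
  fix r
  assume "\<exists>a' b'. a' \<in> polys n \<and> b' \<in> polys n \<and> b' \<noteq> 0 \<and> Fract a b = Fract a' b' \<and>
            r = Fract (poly_act G n R g a') (poly_act G n R g b')"
  then obtain a' b' where *: "a' \<in> polys n" "b' \<in> polys n" "b' \<noteq> 0" "Fract a b = Fract a' b'"
    and r: "r = Fract (poly_act G n R g a') (poly_act G n R g b')"
    by blast
  have "a * b' = a' * b"
    using * ab by (simp add: eq_fract)
  then have "poly_act G n R g a * poly_act G n R g b' = poly_act G n R g a' * poly_act G n R g b"
    using mult * ab by metis
  then show "r = Fract (poly_act G n R g a) (poly_act G n R g b)"
    using r nz * ab by (simp add: eq_fract)
qed


section \<open>The two degrees\<close>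

definition span_over :: "'a::comm_ring_1 set \<Rightarrow> 'a set \<Rightarrow> 'a set"
  where "span_over A S = {\<Sum>s\<in>T. c s * s | T c. finite T \<and> T \<subseteq> S \<and> (\<forall>s\<in>T. c s \<in> A)}"

definition topdeg ::
  "('g, 'b) monoid_scheme \<Rightarrow> nat \<Rightarrow> ('g \<Rightarrow> nat \<Rightarrow> nat \<Rightarrow> 'k::field) \<Rightarrow> nat"
  where "topdeg G n R = (LEAST d. span_over (poly_invs G n R) (polys_le n d) = polys n)"

definition D_span ::
  "('g, 'b) monoid_scheme \<Rightarrow> nat \<Rightarrow> ('g \<Rightarrow> nat \<Rightarrow> nat \<Rightarrow> 'k::field) \<Rightarrow> nat"
  where "D_span G n R =
    (LEAST d. span_over (rat_invs G n R) ((\<lambda>f. Fract f 1) ` polys_le n d) = ratfuns n)"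


section \<open>Permutation representations\<close>

text \<open>The action of \<open>G\<close> on \<open>V\<close> with \<open>g e\<^sub>j = e\<^bsub>\<phi> g j\<^esub>\<close>.\<close>

definition perm_rep :: "('g \<Rightarrow> nat \<Rightarrow> nat) \<Rightarrow> 'g \<Rightarrow> nat \<Rightarrow> nat \<Rightarrow> 'k::zero_neq_one"
  where "perm_rep \<phi> g i j = (if i = \<phi> g j then 1 else 0)"

text \<open>On \<open>k[V]\<close> this is the permutation of the variables \<open>g x\<^sub>i = x\<^bsub>\<phi> g i\<^esub>\<close>, so the orbits on the
  variables are those of \<open>\<phi>\<close> on the indices.\<close>

lemma poly_act_perm_rep_Var:
  assumes "group_action G {1..n} \<phi>" "g \<in> carrier G" "i \<in> {1..n}"
  shows "poly_act G n (perm_rep \<phi>) g (Var i :: 'k::comm_ring_1 mpoly) = Var (\<phi> g i)"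
proof -
  interpret group_action G "{1..n}" \<phi> by fact
  have mem: "\<phi> g i \<in> {1..n}"
    using assms(2,3) element_image by blast
  have inv: "i = \<phi> (inv\<^bsub>G\<^esub> g) j \<longleftrightarrow> j = \<phi> g i" if "j \<in> {1..n}" for j
    using assms that orbit_sym_aux group_hom group_hom.axioms(1) group.inv_closed group.inv_inv
    by metis
  have "(\<Sum>j=1..n. Const (perm_rep \<phi> (inv\<^bsub>G\<^esub> g) i j) * Var j)
      = (\<Sum>j=1..n. if j = \<phi> g i then Var j else (0 :: 'k mpoly))"
    by (rule sum.cong) (auto simp: perm_rep_def inv Const_def)
  also have "\<dots> = Var (\<phi> g i)"
    using mem by simp
  finally show ?thesis
    by (simp add: poly_act_def poly_subst_def Var_def Const_def)
qed

end

theory Submission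
  imports Defs
begin

text \<open>
  Upper bound for \<open>topdeg\<close> (after Goebel). Let \<open>a\<close> be an exponent vector for which some orbit \<open>B\<close>
  and some \<open>j\<close> satisfy: the value \<open>j\<close> is not attained by \<open>a\<close> on \<open>B\<close>, but a larger value is. With
  \<open>S = {i \<in> B. a\<^sub>i > j}\<close> and \<open>e\<close> the elementary symmetric polynomial of degree \<open>|S|\<close> in the variables of
  \<open>B\<close>, which is invariant, the product of \<open>e\<close> and \<open>x\<close> to the power \<open>a - 1\<^sub>S\<close> is the sum over
  \<open>T \<subseteq> B\<close> with \<open>|T| = |S|\<close> of the monomials with exponents \<open>a - 1\<^sub>S + 1\<^sub>T\<close>. The term \<open>T = S\<close> is the
  original monomial, and every other exponent vector, as well as \<open>a - 1\<^sub>S\<close>, has a smaller sum of squares.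
  By induction all monomials are reduced to those whose exponents on each orbit \<open>B\<close> fill an initial
  segment of the naturals; these have degree at most \<open>|B| choose 2\<close> on \<open>B\<close>.

  For \<open>D_span \<le> topdeg\<close>, replace the denominator of a fraction by its norm, which is invariant.
\<close>

section \<open>Polynomial substitution\<close>

lemma poly_mapping_sum_single:
  "(\<Sum>m\<in>Poly_Mapping.keys f. Poly_Mapping.single m (Poly_Mapping.lookup f m)) = f"
  by (rule poly_mapping_eqI)
    (auto simp: lookup_sum lookup_single when_def in_keys_iff)

lemma Const_0 [simp]: "Const 0 = 0"
  and Const_1 [simp]: "Const 1 = 1"
  and Const_add: "Const (a + b) = Const a + Const b"
  and Const_mult: "Const (a * b) = Const a * Const b"
  by (simp_all add: Const_def single_add mult_single)

lemma poly_subst_0 [simp]: "poly_subst s 0 = 0"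
  by (simp add: poly_subst_def)

text \<open>Cancellation may make the support of \<open>f + g\<close> smaller than the union of the
  two supports. The summand is additive in the coefficient and vanishes at coefficient 0, so this
  does no harm.\<close>

lemma poly_subst_add: "poly_subst s (f + g) = poly_subst s f + poly_subst s g"
  unfolding poly_subst_def
  by (rule setsum_keys_plus_distrib) (simp_all add: Const_add ring_distribs)

lemma poly_subst_sum: "poly_subst s (\<Sum>x\<in>A. f x) = (\<Sum>x\<in>A. poly_subst s (f x))"
  by (induction A rule: infinite_finite_induct) (simp_all add: poly_subst_add)

lemma poly_subst_single:
  "poly_subst s (Poly_Mapping.single m c) =
    Const c * (\<Prod>i\<in>Poly_Mapping.keys m. s i ^ Poly_Mapping.lookup m i)"
  by (simp add: poly_subst_def)

text \<open>All three products can run over the union of the two supports, since an absent exponent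
  contributes the factor 1.\<close>

lemma prod_power_lookup_add:
  fixes s :: "'i \<Rightarrow> 'a::comm_monoid_mult"
  shows "(\<Prod>i\<in>Poly_Mapping.keys (m + m'). s i ^ Poly_Mapping.lookup (m + m') i) =
    (\<Prod>i\<in>Poly_Mapping.keys m. s i ^ Poly_Mapping.lookup m i) *
    (\<Prod>i\<in>Poly_Mapping.keys m'. s i ^ Poly_Mapping.lookup m' i)"
proof -
  let ?K = "Poly_Mapping.keys m \<union> Poly_Mapping.keys m'"
  have "(\<Prod>i\<in>Poly_Mapping.keys p. s i ^ Poly_Mapping.lookup p i) =
      (\<Prod>i\<in>?K. s i ^ Poly_Mapping.lookup p i)" if "Poly_Mapping.keys p \<subseteq> ?K" for p
    using that by (intro prod.mono_neutral_left) (auto simp: in_keys_iff)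
  from this[of m] this[of m'] this[of "m + m'"] show ?thesis
    using Poly_Mapping.keys_add[of m m']
    by (simp add: lookup_add power_add flip: prod.distrib)
qed

lemma poly_subst_mult: "poly_subst s (f * g) = poly_subst s f * poly_subst s g"
proof -
  let ?m = "\<lambda>f m. Poly_Mapping.single m (Poly_Mapping.lookup f m)"
  have "f * g = (\<Sum>m\<in>Poly_Mapping.keys f. ?m f m) * (\<Sum>m\<in>Poly_Mapping.keys g. ?m g m)"
    by (simp add: poly_mapping_sum_single)
  also have "poly_subst s \<dots> =
      (\<Sum>m\<in>Poly_Mapping.keys f. poly_subst s (?m f m)) *
      (\<Sum>m\<in>Poly_Mapping.keys g. poly_subst s (?m g m))"
    by (simp add: sum_product poly_subst_sum mult_single poly_subst_single Const_mult
        prod_power_lookup_add mult_ac)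
  also have "\<dots> = poly_subst s f * poly_subst s g"
    by (simp flip: poly_subst_sum add: poly_mapping_sum_single)
  finally show ?thesis .
qed

lemma poly_subst_Const [simp]: "poly_subst s (Const c) = Const c"
  by (simp add: Const_def poly_subst_single)

lemma poly_subst_1 [simp]: "poly_subst s 1 = 1"
  by (metis Const_1 poly_subst_Const)

lemma poly_subst_prod: "poly_subst s (\<Prod>x\<in>A. f x) = (\<Prod>x\<in>A. poly_subst s (f x))"
  by (induction A rule: infinite_finite_induct) (simp_all add: poly_subst_mult)

lemma poly_subst_power: "poly_subst s (f ^ k) = poly_subst s f ^ k"
  by (induction k) (simp_all add: poly_subst_mult)

lemma poly_subst_Var [simp]: "poly_subst s (Var i) = s i"
  by (simp add: Var_def poly_subst_single)

section \<open>Closure properties of \<open>polys n\<close>\<close>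

lemma polys_0 [simp]: "0 \<in> polys n"
  by (simp add: polys_def)

lemma polys_1 [simp]: "1 \<in> polys n"
  by (simp add: polys_def)

lemma polys_Const [simp]: "Const c \<in> polys n"
  by (simp add: polys_def Const_def)

lemma polys_Var: "i \<in> {1..n} \<Longrightarrow> Var i \<in> polys n"
  by (simp add: polys_def Var_def)

lemma polys_add: "f \<in> polys n \<Longrightarrow> g \<in> polys n \<Longrightarrow> f + g \<in> polys n"
  unfolding polys_def using Poly_Mapping.keys_add[of f g] by blast

lemma polys_mult:
  assumes "f \<in> polys n" "g \<in> polys n"
  shows "f * g \<in> polys n"
  unfolding polys_def
proof (intro CollectI ballI)
  fix m assume "m \<in> Poly_Mapping.keys (f * g)"
  then obtain a b where "a \<in> Poly_Mapping.keys f" "b \<in> Poly_Mapping.keys g" "m = a + b"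
    using Poly_Mapping.keys_mult[of f g] by blast
  with assms show "Poly_Mapping.keys m \<subseteq> {1..n}"
    using Poly_Mapping.keys_add[of a b] unfolding polys_def by blast
qed

lemma polys_sum: "(\<And>x. x \<in> A \<Longrightarrow> f x \<in> polys n) \<Longrightarrow> (\<Sum>x\<in>A. f x) \<in> polys n"
  by (induction A rule: infinite_finite_induct) (simp_all add: polys_add)

lemma polys_prod: "(\<And>x. x \<in> A \<Longrightarrow> f x \<in> polys n) \<Longrightarrow> (\<Prod>x\<in>A. f x) \<in> polys n"
  by (induction A rule: infinite_finite_induct) (simp_all add: polys_mult)

lemma polys_power: "f \<in> polys n \<Longrightarrow> f ^ k \<in> polys n"
  by (induction k) (simp_all add: polys_mult)

lemma polys_keys: "f \<in> polys n \<Longrightarrow> m \<in> Poly_Mapping.keys f \<Longrightarrow> Poly_Mapping.keys m \<subseteq> {1..n}"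
  by (simp add: polys_def)

lemma poly_subst_in_polys:
  assumes "f \<in> polys n" "\<And>i. i \<in> {1..n} \<Longrightarrow> s i \<in> polys n"
  shows "poly_subst s f \<in> polys n"
  unfolding poly_subst_def
  using assms by (intro polys_sum polys_mult polys_Const polys_prod polys_power) (blast dest: polys_keys)

text \<open>Allows the matrix form of the action to be replaced by a substitution that agrees with
  it only on the indices in \<open>{1..n}\<close>.\<close>

lemma poly_subst_polys_cong:
  assumes "f \<in> polys n" "\<And>i. i \<in> {1..n} \<Longrightarrow> s i = t i"
  shows "poly_subst s f = poly_subst t f"
  unfolding poly_subst_def
proof (intro sum.cong refl arg_cong2[where f = "(*)"] prod.cong)
  fix m i assume "m \<in> Poly_Mapping.keys f" "i \<in> Poly_Mapping.keys m"
  then show "s i ^ Poly_Mapping.lookup m i = t i ^ Poly_Mapping.lookup m i"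
    using assms polys_keys by (metis subsetD)
qed

lemma poly_subst_poly_subst: "poly_subst s (poly_subst t f) = poly_subst (\<lambda>i. poly_subst s (t i)) f"
  unfolding poly_subst_def [of t] poly_subst_def [of "\<lambda>i. poly_subst s (t i)"]
  by (simp add: poly_subst_sum poly_subst_mult poly_subst_prod poly_subst_power)

lemma prod_Var:
  "finite T \<Longrightarrow> (\<Prod>i\<in>T. Var i) = Poly_Mapping.single (\<Sum>i\<in>T. Poly_Mapping.single i 1) 1"
  by (induction T rule: finite_induct) (simp_all add: Var_def mult_single)

lemma single_eq_prod_Var:
  fixes c :: "'a::comm_ring_1"
  shows "Poly_Mapping.single m c = Const c * (\<Prod>i\<in>Poly_Mapping.keys m. Var i ^ Poly_Mapping.lookup m i)"
proof -
  have pow: "Var i ^ k = Poly_Mapping.single (Poly_Mapping.single i k) (1::'a)" for i k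
    by (induction k) (simp_all add: Var_def mult_single flip: single_add)
  have "(\<Prod>i\<in>A. Poly_Mapping.single (Poly_Mapping.single i (f i)) (1::'a)) =
      Poly_Mapping.single (\<Sum>i\<in>A. Poly_Mapping.single i (f i)) 1" if "finite A" for A and f :: "nat \<Rightarrow> nat"
    using that by (induction A rule: finite_induct) (simp_all add: mult_single)
  then show ?thesis
    by (simp add: pow poly_mapping_sum_single Const_def mult_single)
qed

lemma poly_subst_Var_id: "poly_subst Var f = f"
  unfolding poly_subst_def by (simp flip: single_eq_prod_Var add: poly_mapping_sum_single)


section \<open>Spans over a subring\<close>

locale subring_set =
  fixes A :: "'a::comm_ring_1 set"
  assumes zero_in [simp]: "0 \<in> A" and one_in [simp]: "1 \<in> A"
    and add_in: "a \<in> A \<Longrightarrow> b \<in> A \<Longrightarrow> a + b \<in> A"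
    and mult_in: "a \<in> A \<Longrightarrow> b \<in> A \<Longrightarrow> a * b \<in> A"
begin

lemma span_over_base: "s \<in> S \<Longrightarrow> s \<in> span_over A S"
  unfolding span_over_def by (intro CollectI exI[of _ "{s}"] exI[of _ "\<lambda>_. 1"]) simp

lemma span_over_0: "0 \<in> span_over A S"
  unfolding span_over_def by (intro CollectI exI[of _ "{}"]) simp

lemma span_over_add:
  assumes "x \<in> span_over A S" "y \<in> span_over A S"
  shows "x + y \<in> span_over A S"
proof -
  from assms obtain T c U d where
    T: "finite T" "T \<subseteq> S" "\<forall>s\<in>T. c s \<in> A" "x = (\<Sum>s\<in>T. c s * s)" and
    U: "finite U" "U \<subseteq> S" "\<forall>s\<in>U. d s \<in> A" "y = (\<Sum>s\<in>U. d s * s)"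
    unfolding span_over_def by auto
  \<comment> \<open>Both coefficient functions are extended by zero to \<open>T \<union> U\<close>,
    so that an element of both sets receives the sum of its two coefficients.\<close>
  let ?c = "\<lambda>s. if s \<in> T then c s else 0" and ?d = "\<lambda>s. if s \<in> U then d s else 0"
  have "x = (\<Sum>s\<in>T \<union> U. ?c s * s)"
    unfolding T(4) using T U by (intro sum.mono_neutral_cong_left) auto
  moreover have "y = (\<Sum>s\<in>T \<union> U. ?d s * s)"
    unfolding U(4) using T U by (intro sum.mono_neutral_cong_left) auto
  ultimately have "x + y = (\<Sum>s\<in>T \<union> U. (?c s + ?d s) * s)"
    by (simp only: sum.distrib ring_distribs)
  moreover have "\<forall>s\<in>T \<union> U. ?c s + ?d s \<in> A"
    using T U by (auto intro: add_in)
  ultimately show ?thesis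
    unfolding span_over_def using T U
    by (intro CollectI exI[of _ "T \<union> U"] exI[of _ "\<lambda>s. ?c s + ?d s"]) blast
qed

lemma span_over_sum: "(\<And>x. x \<in> X \<Longrightarrow> f x \<in> span_over A S) \<Longrightarrow> (\<Sum>x\<in>X. f x) \<in> span_over A S"
  by (induction X rule: infinite_finite_induct) (simp_all add: span_over_0 span_over_add)

lemma span_over_scale:
  assumes "a \<in> A" "x \<in> span_over A S"
  shows "a * x \<in> span_over A S"
proof -
  from assms obtain T c where
    T: "finite T" "T \<subseteq> S" "\<forall>s\<in>T. c s \<in> A" "x = (\<Sum>s\<in>T. c s * s)"
    unfolding span_over_def by auto
  have "a * x = (\<Sum>s\<in>T. (a * c s) * s)"
    by (simp add: T(4) sum_distrib_left mult_ac)
  with T assms(1) show ?thesis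
    unfolding span_over_def
    by (intro CollectI exI[of _ T] exI[of _ "\<lambda>s. a * c s"]) (auto intro: mult_in)
qed

end

text \<open>Stated outside the locale so that it also applies to \<open>rat_invs\<close>, which is
  not shown to be a subring.\<close>

lemma span_over_subset:
  assumes "\<And>x y. x \<in> B \<Longrightarrow> y \<in> B \<Longrightarrow> x + y \<in> B" "0 \<in> B"
    "\<And>a s. a \<in> A \<Longrightarrow> s \<in> S \<Longrightarrow> a * s \<in> B"
  shows "span_over A S \<subseteq> B"
proof -
  have "(\<Sum>s\<in>T. c s * s) \<in> B" if "finite T" "T \<subseteq> S" "\<forall>s\<in>T. c s \<in> A" for T c
    using that by (induction T rule: finite_induct) (auto intro: assms)
  then show ?thesis
    unfolding span_over_def by blast
qed


section \<open>Counting\<close>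

text \<open>A pair in a disjoint union lies in the first part, lies in the second, or is mixed; the
  last kind gives \<open>a * b\<close>.\<close>

lemma choose_two_add: "(a + b) choose 2 = (a choose 2) + (b choose 2) + a * b"
  for a b :: nat
  by (induction b) (simp_all add: numeral_2_eq_2)

text \<open>Each insertion of a block only drops the mixed pairs of
  \<open>choose_two_add\<close>.\<close>

lemma sum_card_choose_two_le:
  assumes "finite P" "\<And>B. B \<in> P \<Longrightarrow> finite B" "pairwise disjnt P"
  shows "(\<Sum>B\<in>P. card B choose 2) \<le> card (\<Union>P) choose 2"
  using assms
proof (induction P rule: finite_induct)
  case (insert B P)
  then have "B \<inter> \<Union>P = {}"
    unfolding pairwise_insert disjnt_def by blast
  with insert have "card (\<Union>(insert B P)) = card B + card (\<Union>P)"
    by (simp add: card_Un_disjoint)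
  with insert show ?case
    by (simp add: choose_two_add pairwise_insert)
qed simp

text \<open>The values of \<open>f\<close> fill an initial segment of the naturals, so the maximum
  is at most \<open>card B - 1\<close>. Removing one point where it is attained keeps the
  hypothesis, and the bounds add up to 0 + 1 + ... + (\<open>card B\<close> - 1).\<close>

lemma sum_le_choose_two:
  fixes f :: "'a \<Rightarrow> nat"
  assumes "finite B" "\<And>x j. x \<in> B \<Longrightarrow> j < f x \<Longrightarrow> j \<in> f ` B"
  shows "sum f B \<le> card B choose 2"
  using assms
proof (induction "card B" arbitrary: B)
  case (Suc k)
  then have "B \<noteq> {}"
    by auto
  then have "Max (f ` B) \<in> f ` B"
    using Suc.prems(1) by simp
  then obtain x where x: "x \<in> B" "f x = Max (f ` B)"
    by auto
  then have max: "f y \<le> f x" if "y \<in> B" for y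
    using that Suc.prems(1) by simp
  have "{..f x} \<subseteq> f ` B"
    using x(1) Suc.prems(2) by (force simp: le_less)
  then have "Suc (f x) \<le> card (f ` B)"
    using card_mono[of "f ` B" "{..f x}"] Suc.prems(1) by simp
  also have "\<dots> \<le> Suc k"
    using card_image_le[OF Suc.prems(1)] Suc.hyps(2) by metis
  finally have "f x \<le> k"
    by simp
  moreover have card: "card (B - {x}) = k"
    using x Suc by simp
  then have "sum f (B - {x}) \<le> card (B - {x}) choose 2"
  proof (intro Suc.hyps(1))
    fix y j assume y: "y \<in> B - {x}" "j < f y"
    then obtain z where "z \<in> B" "f z = j"
      using Suc.prems(2)[of y j] by blast
    \<comment> \<open>\<open>x\<close> attains the maximum, whereas \<open>f z = j\<close> is below
      \<open>f y\<close>; hence every required value survives the removal of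
      \<open>x\<close>.\<close>
    moreover have "z \<noteq> x"
      using y max[of y] \<open>f z = j\<close> by auto
    ultimately show "j \<in> f ` (B - {x})"
      by blast
  qed (use Suc.prems in auto)
  moreover have "sum f B = f x + sum f (B - {x})"
    using x(1) Suc.prems(1) by (rule sum.remove[rotated])
  moreover have "card B choose 2 = k + (k choose 2)"
    by (simp flip: Suc.hyps(2) add: numeral_2_eq_2)
  ultimately show ?case
    using card by simp
qed simp

text \<open>The common part cancels. \<open>T - S\<close> and \<open>S - T\<close> are nonempty of
  equal size, and the threshold \<open>c\<close> separates their weights.\<close>

lemma sum_less_top_subset:
  fixes w :: "'a \<Rightarrow> nat"
  assumes fin: "finite S" "finite T" and card: "card T = card S" and ne: "T \<noteq> S"
    and top: "\<And>i. i \<in> S \<Longrightarrow> c \<le> w i" and low: "\<And>i. i \<in> T - S \<Longrightarrow> w i < c"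
  shows "sum w T < sum w S"
proof -
  have eq: "card (T - S) = card (S - T)"
    using fin card by (metis card_Diff_subset_Int finite_Int inf_commute)
  have "T - S \<noteq> {}"
    using fin card ne by (metis Diff_eq_empty_iff card_subset_eq)
  then have "sum w (T - S) < of_nat (card (T - S)) * c"
    using fin low by (intro sum_bounded_above_strict) (auto simp: card_gt_0_iff)
  also have "\<dots> \<le> sum w (S - T)"
    unfolding eq using top by (intro sum_bounded_below) auto
  finally have "sum w (T - S) < sum w (S - T)" .
  moreover have "sum w T = sum w (T \<inter> S) + sum w (T - S)"
    using fin(2) by (rule sum.Int_Diff)
  moreover have "sum w S = sum w (T \<inter> S) + sum w (S - T)"
    using sum.Int_Diff[OF fin(1), of w T] by (simp add: Int_commute)
  ultimately show ?thesis
    by simp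
qed


section \<open>Fractions\<close>

lemma Fract_sum:
  fixes f :: "'a \<Rightarrow> 'b::idom"
  shows "N \<noteq> 0 \<Longrightarrow> Fract (\<Sum>x\<in>X. f x) N = (\<Sum>x\<in>X. Fract (f x) N)"
proof (induction X rule: infinite_finite_induct)
  case (insert x F)
  have "Fract (a + b) N = Fract a N + Fract b N" for a b
    using insert.prems by (simp add: eq_fract algebra_simps)
  with insert show ?case
    by (simp del: add_fract)
qed (simp_all add: fract_collapse)

lemma ratfunsI: "a \<in> polys n \<Longrightarrow> b \<in> polys n \<Longrightarrow> b \<noteq> 0 \<Longrightarrow> Fract a b \<in> ratfuns n"
  unfolding ratfuns_def by blast

lemma ratfunsE:
  assumes "q \<in> ratfuns n"
  obtains a b where "a \<in> polys n" "b \<in> polys n" "b \<noteq> 0" "q = Fract a b"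
  using assms unfolding ratfuns_def by blast

lemma ratfuns_0: "0 \<in> ratfuns n"
  unfolding Zero_fract_def by (rule ratfunsI) simp_all

lemma ratfuns_add: "x \<in> ratfuns n \<Longrightarrow> y \<in> ratfuns n \<Longrightarrow> x + y \<in> ratfuns n"
  by (elim ratfunsE) (simp add: ratfunsI polys_add polys_mult)

lemma ratfuns_mult: "x \<in> ratfuns n \<Longrightarrow> y \<in> ratfuns n \<Longrightarrow> x * y \<in> ratfuns n"
  by (elim ratfunsE) (simp add: ratfunsI polys_mult)


section \<open>Finite permutation actions on polynomials\<close>

locale finite_perm_action = group_action G "{1..n}" \<phi>
  for G :: "('g, 'b) monoid_scheme" (structure) and n :: nat and \<phi> :: "'g \<Rightarrow> nat \<Rightarrow> nat" +
  assumes finite_carrier: "finite (carrier G)"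
begin

sublocale group G
  using group_hom group_hom.axioms(1) by blast

abbreviation act :: "'g \<Rightarrow> 'k::comm_ring_1 mpoly \<Rightarrow> 'k mpoly"
  where "act \<equiv> poly_act G n (perm_rep \<phi>)"

abbreviation invs :: "'k::comm_ring_1 mpoly set"
  where "invs \<equiv> poly_invs G n (perm_rep \<phi>)"

lemma act_Var: "g \<in> carrier G \<Longrightarrow> i \<in> {1..n} \<Longrightarrow> act g (Var i) = Var (\<phi> g i)"
  by (rule poly_act_perm_rep_Var) (rule group_action_axioms)

lemma act_add: "act g (a + b) = act g a + act g b"
  and act_mult: "act g (a * b) = act g a * act g b"
  and act_0: "act g 0 = 0" and act_1: "act g 1 = 1" and act_Const: "act g (Const c) = Const c"
  and act_sum: "act g (\<Sum>x\<in>X. f x) = (\<Sum>x\<in>X. act g (f x))"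
  and act_prod: "act g (\<Prod>x\<in>X. f x) = (\<Prod>x\<in>X. act g (f x))"
  by (simp_all add: poly_act_def poly_subst_add poly_subst_mult poly_subst_sum poly_subst_prod)

lemma act_in_polys: "f \<in> polys n \<Longrightarrow> act g f \<in> polys n"
  unfolding poly_act_def
  by (intro poly_subst_in_polys polys_sum polys_mult polys_Const polys_Var)

text \<open>On \<open>polys n\<close> the action is determined by the images of the variables, so
  the matrices can be left behind.\<close>

lemma act_eq_poly_subst:
  assumes "f \<in> polys n" "\<And>i. i \<in> {1..n} \<Longrightarrow> act g (Var i) = s i"
  shows "act g f = poly_subst s f"
  unfolding poly_act_def using assms
  by (intro poly_subst_polys_cong) (simp_all add: poly_act_def)

lemma act_act:
  assumes "f \<in> polys n" "g \<in> carrier G" "h \<in> carrier G"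
  shows "act g (act h f) = act (g \<otimes> h) f"
proof -
  have "act g (act h f) = act g (poly_subst (\<lambda>i. Var (\<phi> h i)) f)"
    using assms by (subst act_eq_poly_subst[where g = h]) (auto intro: act_Var)
  also have "\<dots> = poly_subst (\<lambda>i. act g (Var (\<phi> h i))) f"
    by (simp add: poly_act_def poly_subst_poly_subst)
  also have "\<dots> = act (g \<otimes> h) f"
  proof (rule act_eq_poly_subst[symmetric])
    fix i assume i: "i \<in> {1..n}"
    then have "\<phi> h i \<in> {1..n}"
      using assms element_image by blast
    then show "act (g \<otimes> h) (Var i) = act g (Var (\<phi> h i))"
      using i assms by (simp only: act_Var m_closed composition_rule)
  qed fact
  finally show ?thesis .
qed

text \<open>Membership in \<open>polys n\<close> matters: \<open>act \<one>\<close> sends each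
  variable with index outside \<open>{1..n}\<close> to 0.\<close>

lemma act_one:
  assumes "f \<in> polys n"
  shows "act \<one> f = f"
proof -
  have "act \<one> f = poly_subst Var f"
  proof (rule act_eq_poly_subst)
    fix i assume "i \<in> {1..n}"
    moreover from this have "\<phi> \<one> i = i"
      using id_eq_one by (metis restrict_apply')
    ultimately show "act \<one> (Var i) = Var i"
      by (simp only: act_Var one_closed)
  qed fact
  then show ?thesis
    by (simp add: poly_subst_Var_id)
qed

text \<open>Acting with \<open>inv g\<close> recovers \<open>f\<close>. This meets a hypothesis of
  \<open>rat_act_Fract\<close> and keeps the norm of a denominator nonzero.\<close>

lemma act_nonzero:
  assumes "f \<in> polys n" "g \<in> carrier G" "f \<noteq> 0"
  shows "act g f \<noteq> 0"
proof
  assume "act g f = 0"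
  moreover have "act (inv g) (act g f) = f"
    using assms by (simp add: act_act act_one)
  ultimately show False
    using assms(3) by (simp add: act_0)
qed

sublocale subring_set "invs :: 'k::comm_ring_1 mpoly set"
  by unfold_locales (auto simp: poly_invs_def act_0 act_1 act_add act_mult polys_add polys_mult)

lemma Const_in_invs: "Const c \<in> invs"
  by (simp add: poly_invs_def act_Const)

section \<open>Orbits and their elementary symmetric polynomials\<close>

lemma orbit_subset: "B \<in> orbits G {1..n} \<phi> \<Longrightarrow> B \<subseteq> {1..n}"
  using orbits_coverture by blast

lemma finite_orbit: "B \<in> orbits G {1..n} \<phi> \<Longrightarrow> finite B"
  using finite_subset[OF orbit_subset] by simp

text \<open>An orbit is mapped into itself, and an injective self-map of a finite set is
  onto.\<close>

lemma image_orbit: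
  assumes "g \<in> carrier G" "B \<in> orbits G {1..n} \<phi>"
  shows "\<phi> g ` B = B"
proof (rule endo_inj_surj)
  from assms obtain x where x: "x \<in> {1..n}" "B = orbit G \<phi> x"
    unfolding orbits_def by blast
  show "finite B"
    using assms(2) by (rule finite_orbit)
  show "inj_on (\<phi> g) B"
    using inj_prop[OF assms(1)] orbit_subset[OF assms(2)] by (rule inj_on_subset)
  show "\<phi> g ` B \<subseteq> B"
    using x assms(1) unfolding orbit_def
    by (auto simp flip: composition_rule)
qed

text \<open>This is the elementary symmetric polynomial of degree \<open>k\<close> in the variables
  of \<open>B\<close>. Since \<open>\<phi> g\<close> permutes the \<open>k\<close>-subsets of
  \<open>B\<close>, the action only reorders the summands.\<close>

lemma esym_orbit_in_invs:
  assumes "B \<in> orbits G {1..n} \<phi>"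
  shows "(\<Sum>T | T \<subseteq> B \<and> card T = k. \<Prod>i\<in>T. Var i) \<in> invs"
proof -
  let ?P = "{T. T \<subseteq> B \<and> card T = k}"
  have sub: "B \<subseteq> {1..n}" and fin: "finite B"
    using assms by (rule orbit_subset, rule finite_orbit)
  have "act g (\<Sum>T\<in>?P. \<Prod>i\<in>T. Var i) = (\<Sum>T\<in>?P. \<Prod>i\<in>T. Var i)"
    if g: "g \<in> carrier G" for g
  proof -
    have inj: "inj_on (\<phi> g) T" if "T \<subseteq> B" for T
      using inj_prop[OF g] that sub by (meson inj_on_subset order.trans)
    have inj': "inj_on ((`) (\<phi> g)) ?P"
      by (rule inj_on_subset[OF inj_on_image_Pow[OF inj[OF order.refl]]]) auto
    have img: "(`) (\<phi> g) ` ?P = ?P"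
    proof (rule endo_inj_surj)
      show "(`) (\<phi> g) ` ?P \<subseteq> ?P"
        using image_orbit[OF g assms] card_image[OF inj] by auto
    qed (use inj' fin in auto)
    have "act g (\<Sum>T\<in>?P. \<Prod>i\<in>T. Var i) = (\<Sum>T\<in>?P. \<Prod>i\<in>T. Var (\<phi> g i))"
      unfolding act_sum act_prod using sub g
      by (intro sum.cong prod.cong refl act_Var) auto
    also have "\<dots> = (\<Sum>T\<in>?P. \<Prod>i\<in>\<phi> g ` T. Var i)"
      by (intro sum.cong refl) (simp add: prod.reindex[OF inj])
    also have "\<dots> = (\<Sum>T\<in>(`) (\<phi> g) ` ?P. \<Prod>i\<in>T. Var i)"
      by (simp add: sum.reindex[OF inj'])
    finally show ?thesis
      unfolding img .
  qed
  moreover have "(\<Sum>T\<in>?P. \<Prod>i\<in>T. Var i) \<in> polys n"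
    using sub by (intro polys_sum polys_prod polys_Var) auto
  ultimately show ?thesis
    unfolding poly_invs_def by blast
qed

section \<open>Reduction of monomials to bounded degree\<close>

definition goebel_bound :: nat
  where "goebel_bound = (\<Sum>B\<in>orbits G {1..n} \<phi>. card B choose 2)"

text \<open>The orbits partition \<open>{1..n}\<close>, and \<open>special\<close> is the hypothesis
  of \<open>sum_le_choose_two\<close> on each of them.\<close>

lemma degree_le_goebel_bound:
  assumes m: "Poly_Mapping.keys m \<subseteq> {1..n}"
    and special: "\<And>B x j. B \<in> orbits G {1..n} \<phi> \<Longrightarrow> x \<in> B \<Longrightarrow> j < Poly_Mapping.lookup m x \<Longrightarrow>
      j \<in> Poly_Mapping.lookup m ` B"
  shows "(\<Sum>i\<in>Poly_Mapping.keys m. Poly_Mapping.lookup m i) \<le> goebel_bound"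
proof -
  have "(\<Sum>i\<in>Poly_Mapping.keys m. Poly_Mapping.lookup m i) = (\<Sum>i\<in>{1..n}. Poly_Mapping.lookup m i)"
    using m by (intro sum.mono_neutral_left) (auto simp: in_keys_iff)
  also have "\<dots> = (\<Sum>B\<in>orbits G {1..n} \<phi>. \<Sum>i\<in>B. Poly_Mapping.lookup m i)"
    by (rule disjoint_sum[symmetric]) simp
  also have "\<dots> \<le> goebel_bound"
    unfolding goebel_bound_def
    by (intro sum_mono sum_le_choose_two finite_orbit special)
  finally show ?thesis .
qed

abbreviation low_span :: "'k::comm_ring_1 mpoly set"
  where "low_span \<equiv> span_over invs (polys_le n goebel_bound)"

lemma monomial_in_low_span:
  assumes "Poly_Mapping.keys m \<subseteq> {1..n}"
  shows "Poly_Mapping.single m (1::'k::comm_ring_1) \<in> low_span"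
  using assms
proof (induction "\<Sum>i\<in>{1..n}. (Poly_Mapping.lookup m i)\<^sup>2" arbitrary: m rule: less_induct)
  case less
  let ?l = Poly_Mapping.lookup
  show ?case
  proof (cases "\<forall>B\<in>orbits G {1..n} \<phi>. \<forall>x\<in>B. \<forall>j<?l m x. j \<in> ?l m ` B")
    case True
    then have "(\<Sum>i\<in>Poly_Mapping.keys m. ?l m i) \<le> goebel_bound"
      by (intro degree_le_goebel_bound less.prems) blast
    then have "Poly_Mapping.single m 1 \<in> polys_le n goebel_bound"
      using less.prems by (simp add: polys_le_def polys_def)
    then show ?thesis
      by (rule span_over_base)
  next
    case False
    then obtain B x j where B: "B \<in> orbits G {1..n} \<phi>" and x: "x \<in> B" "j < ?l m x"
      and gap: "j \<notin> ?l m ` B"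
      by blast
    define S where "S = {i\<in>B. j < ?l m i}"
    \<comment> \<open>For finite \<open>T\<close>, \<open>ind T\<close> is the exponent vector of
      the squarefree monomial \<open>\<Prod>i\<in>T. Var i\<close>.\<close>
    define ind :: "nat set \<Rightarrow> nat \<Rightarrow>\<^sub>0 nat" where "ind T = (\<Sum>i\<in>T. Poly_Mapping.single i 1)" for T
    \<comment> \<open>This subtraction is truncated, but exponents on \<open>S\<close> are positive,
      so \<open>m = ind S + m'\<close> will hold.\<close>
    define m' where "m' = m - ind S"
    let ?P = "{T. T \<subseteq> B \<and> card T = card S}"
    let ?e = "\<Sum>T\<in>?P. \<Prod>i\<in>T. Var i :: 'k mpoly"
    have B_sub: "B \<subseteq> {1..n}" and fin_B: "finite B"
      using B by (rule orbit_subset, rule finite_orbit)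
    have S: "S \<subseteq> B" "x \<in> S" "finite S"
      using x fin_B by (auto simp: S_def)
    have lookup_ind: "?l (ind T) i = (if i \<in> T then 1 else 0)" if "finite T" for T i
      using that by (simp add: ind_def lookup_sum lookup_single when_def)
    have lookup_m': "?l m' i = (if i \<in> S then ?l m i - 1 else ?l m i)" for i
      by (simp add: m'_def lookup_minus lookup_ind S)
    have pos: "0 < ?l m i" if "i \<in> S" for i
      using that by (auto simp: S_def)
    have m: "m = ind S + m'"
      by (rule poly_mapping_eqI) (simp add: lookup_add lookup_m' lookup_ind[OF S(3)] Suc_leI pos)
    have keys_m': "Poly_Mapping.keys m' \<subseteq> {1..n}"
      using less.prems by (auto simp: in_keys_iff lookup_m' split: if_splits)
    \<comment> \<open>Raising an exponent \<open>a\<close> by one adds \<open>2 * a + 1\<close> to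
      its square. Comparing the measures for \<open>T\<close> and \<open>S\<close> thus becomes a
      comparison of two sums of fixed weights.\<close>
    have weight: "(\<Sum>i\<in>{1..n}. (?l (ind T + m') i)\<^sup>2) =
        (\<Sum>i\<in>{1..n}. (?l m' i)\<^sup>2) + (\<Sum>i\<in>T. 2 * ?l m' i + 1)" if "T \<subseteq> B" for T
    proof -
      have T: "finite T" "{1..n} \<inter> T = T"
        using that fin_B B_sub finite_subset by auto
      have "(\<Sum>i\<in>{1..n}. (?l (ind T + m') i)\<^sup>2) =
          (\<Sum>i\<in>{1..n}. (?l m' i)\<^sup>2 + (if i \<in> T then 2 * ?l m' i + 1 else 0))"
        by (intro sum.cong refl) (simp add: lookup_add lookup_ind T power2_eq_square)
      also have "\<dots> = (\<Sum>i\<in>{1..n}. (?l m' i)\<^sup>2) + (\<Sum>i\<in>{1..n}. if i \<in> T then 2 * ?l m' i + 1 else 0)"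
        by (rule sum.distrib)
      also have "(\<Sum>i\<in>{1..n}. if i \<in> T then 2 * ?l m' i + 1 else 0) = (\<Sum>i\<in>T. 2 * ?l m' i + 1)"
        using sum.inter_restrict[of "{1..n}" "\<lambda>i. 2 * ?l m' i + 1" T] unfolding T(2) by simp
      finally show ?thesis .
    qed
    have m'_in: "Poly_Mapping.single m' (1::'k) \<in> low_span"
    proof (rule less.hyps)
      have "0 < (\<Sum>i\<in>S. 2 * ?l m' i + 1)"
        using S by (intro sum_pos) auto
      then show "(\<Sum>i\<in>{1..n}. (?l m' i)\<^sup>2) < (\<Sum>i\<in>{1..n}. (?l m i)\<^sup>2)"
        unfolding m weight[OF S(1)] by simp
    qed fact
    have other_in: "Poly_Mapping.single (ind T + m') (1::'k) \<in> low_span"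
      if T: "T \<in> ?P - {S}" for T
    proof (rule less.hyps)
      have "finite T"
        using T fin_B finite_subset by auto
      \<comment> \<open>The gap gives strictness: outside \<open>S\<close> an exponent is at most
        \<open>j\<close> and differs from \<open>j\<close>, while on \<open>S\<close> it is still at
        least \<open>j\<close> after being lowered by one.\<close>
      moreover have "2 * ?l m' i + 1 < 2 * j + 1" if "i \<in> T - S" for i
      proof -
        have "i \<in> B" "?l m i \<noteq> j"
          using that T gap by auto
        then show ?thesis
          using that by (auto simp: lookup_m' S_def)
      qed
      moreover have "2 * j + 1 \<le> 2 * ?l m' i + 1" if "i \<in> S" for i
        using that by (auto simp: lookup_m' S_def)
      ultimately have "(\<Sum>i\<in>T. 2 * ?l m' i + 1) < (\<Sum>i\<in>S. 2 * ?l m' i + 1)"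
        using T S by (intro sum_less_top_subset[where c = "2 * j + 1"]) auto
      then show "(\<Sum>i\<in>{1..n}. (?l (ind T + m') i)\<^sup>2) < (\<Sum>i\<in>{1..n}. (?l m i)\<^sup>2)"
        using T weight[of T] weight[OF S(1)] by (simp flip: m)
      show "Poly_Mapping.keys (ind T + m') \<subseteq> {1..n}"
      proof
        fix i assume "i \<in> Poly_Mapping.keys (ind T + m')"
        then have "i \<in> T \<or> i \<in> Poly_Mapping.keys m'"
          by (auto simp: in_keys_iff lookup_add lookup_ind[OF \<open>finite T\<close>] split: if_splits)
        then show "i \<in> {1..n}"
          using keys_m' T B_sub by blast
      qed
    qed
    have "?e * Poly_Mapping.single m' 1 = (\<Sum>T\<in>?P. Poly_Mapping.single (ind T + m') 1)"
      unfolding sum_distrib_right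
      using fin_B by (intro sum.cong refl) (auto simp: prod_Var finite_subset mult_single ind_def)
    also have "\<dots> = Poly_Mapping.single m 1 + (\<Sum>T\<in>?P - {S}. Poly_Mapping.single (ind T + m') 1)"
      using fin_B S(1) by (subst sum.remove[of _ S]) (auto simp flip: m)
    \<comment> \<open>The equation is solved for the term \<open>T = S\<close>. The sign is written
      as the invariant \<open>Const (-1)\<close>, so that closure under scaling covers it.\<close>
    finally have "Poly_Mapping.single m 1 =
        ?e * Poly_Mapping.single m' 1 + Const (-1) * (\<Sum>T\<in>?P - {S}. Poly_Mapping.single (ind T + m') 1)"
      by (simp add: Const_def single_uminus)
    also have "\<dots> \<in> low_span"
      by (intro span_over_add span_over_scale span_over_sum other_in m'_in esym_orbit_in_invs Const_in_invs B)
    finally show ?thesis .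
  qed
qed

text \<open>Constants are invariant, so it suffices to have the monomials.\<close>

lemma low_span_eq_polys: "low_span = (polys n :: 'k::comm_ring_1 mpoly set)"
proof
  show "low_span \<subseteq> (polys n :: 'k mpoly set)"
    by (rule span_over_subset) (auto simp: polys_add polys_mult polys_le_def poly_invs_def)
  show "(polys n :: 'k mpoly set) \<subseteq> low_span"
  proof
    fix f :: "'k mpoly" assume f: "f \<in> polys n"
    have "f = (\<Sum>m\<in>Poly_Mapping.keys f. Const (Poly_Mapping.lookup f m) * Poly_Mapping.single m 1)"
      by (simp add: Const_def mult_single poly_mapping_sum_single)
    also have "\<dots> \<in> low_span"
      using f by (intro span_over_sum span_over_scale Const_in_invs monomial_in_low_span polys_keys)
    finally show "f \<in> low_span" .
  qed
qed

section \<open>Norms and the passage to fractions\<close>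

text \<open>Left multiplication by \<open>h\<close> permutes the factors of the norm.\<close>

lemma norm_in_invs:
  assumes "b \<in> polys n"
  shows "(\<Prod>g\<in>carrier G. act g b) \<in> invs"
proof -
  have "act h (\<Prod>g\<in>carrier G. act g b) = (\<Prod>g\<in>carrier G. act g b)" if h: "h \<in> carrier G" for h
  proof -
    have "act h (\<Prod>g\<in>carrier G. act g b) = (\<Prod>g\<in>carrier G. act (h \<otimes> g) b)"
      unfolding act_prod using assms h by (intro prod.cong refl act_act)
    also have "\<dots> = (\<Prod>g\<in>carrier G. act g b)"
      by (rule prod.reindex_bij_witness[of _ "\<lambda>g. inv h \<otimes> g" "\<lambda>g. h \<otimes> g"])
        (use h in \<open>simp_all flip: m_assoc\<close>)
    finally show ?thesis .
  qed
  with assms show ?thesis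
    by (auto simp: poly_invs_def intro!: polys_prod act_in_polys)
qed

lemma Fract_in_rat_invs:
  fixes a b :: "'k::field mpoly"
  assumes "a \<in> invs" "b \<in> invs" "b \<noteq> 0"
  shows "Fract a b \<in> rat_invs G n (perm_rep \<phi>)"
proof -
  have ab: "a \<in> polys n" "b \<in> polys n"
    using assms by (auto simp: poly_invs_def)
  have "rat_act G n (perm_rep \<phi>) g (Fract a b) = Fract a b" if g: "g \<in> carrier G" for g
    using assms g by (subst rat_act_Fract) (auto simp: act_mult act_nonzero ab poly_invs_def)
  with ab assms(3) show ?thesis
    by (simp add: rat_invs_def ratfunsI)
qed

text \<open>The same \<open>d\<close> serves for fractions: once the denominator is an invariant
  \<open>N\<close>, the numerator is expanded over the invariants and each coefficient is divided by
  \<open>N\<close>.\<close>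

lemma rat_span_eq_ratfuns:
  assumes span: "span_over invs (polys_le n d) = (polys n :: 'k::field mpoly set)"
  shows "span_over (rat_invs G n (perm_rep \<phi>)) ((\<lambda>f. Fract f 1) ` polys_le n d) =
    (ratfuns n :: 'k mpoly fract set)"
proof
  show "span_over (rat_invs G n (perm_rep \<phi>)) ((\<lambda>f. Fract f 1) ` polys_le n d) \<subseteq>
      (ratfuns n :: 'k mpoly fract set)"
  proof (rule span_over_subset)
    fix a s :: "'k mpoly fract"
    assume "a \<in> rat_invs G n (perm_rep \<phi>)" "s \<in> (\<lambda>f. Fract f 1) ` polys_le n d"
    then have "a \<in> ratfuns n" "s \<in> ratfuns n"
      by (auto simp: rat_invs_def polys_le_def intro: ratfunsI)
    then show "a * s \<in> ratfuns n"
      by (rule ratfuns_mult)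
  qed (simp_all add: ratfuns_0 ratfuns_add)
next
  show "(ratfuns n :: 'k mpoly fract set) \<subseteq>
      span_over (rat_invs G n (perm_rep \<phi>)) ((\<lambda>f. Fract f 1) ` polys_le n d)"
  proof
    fix q :: "'k mpoly fract" assume "q \<in> ratfuns n"
    then obtain a b where ab: "a \<in> polys n" "b \<in> polys n" "b \<noteq> 0" "q = Fract a b"
      by (rule ratfunsE)
    define N where "N = (\<Prod>g\<in>carrier G. act g b)"
    \<comment> \<open>\<open>c\<close> is the product of the remaining conjugates of
      \<open>b\<close>, so \<open>a / b = (a * c) / N\<close>.\<close>
    define c where "c = (\<Prod>g\<in>carrier G - {\<one>}. act g b)"
    have N: "N = b * c"
      using ab by (simp add: N_def c_def prod.remove[OF finite_carrier one_closed] act_one)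
    have N_nz: "N \<noteq> 0"
      using ab finite_carrier by (simp add: N_def act_nonzero)
    have N_inv: "N \<in> invs"
      unfolding N_def using ab(2) by (rule norm_in_invs)
    have "a * c \<in> polys n"
      unfolding c_def using ab by (intro polys_mult polys_prod act_in_polys)
    then obtain T k where T: "finite T" "T \<subseteq> polys_le n d" "\<forall>s\<in>T. k s \<in> invs"
      and ac: "a * c = (\<Sum>s\<in>T. k s * s)"
      unfolding span[symmetric] span_over_def by blast
    let ?F = "\<lambda>f. Fract f 1 :: 'k mpoly fract"
    have inj: "inj_on ?F T"
      by (rule inj_onI) (simp add: eq_fract)
    \<comment> \<open>Coefficients in \<open>span_over\<close> are functions of the spanning
      element, here a fraction \<open>s / 1\<close>; \<open>inv_into\<close> recovers
      \<open>s\<close> from it.\<close>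
    define C where "C x = Fract (k (inv_into T ?F x)) N" for x
    have "q = Fract (a * c) N"
      using ab N N_nz by (simp add: eq_fract)
    also have "\<dots> = (\<Sum>s\<in>T. C (?F s) * ?F s)"
      unfolding ac Fract_sum[OF N_nz]
      by (intro sum.cong refl) (simp add: C_def inv_into_f_f[OF inj])
    also have "\<dots> = (\<Sum>x\<in>?F ` T. C x * x)"
      by (simp add: sum.reindex[OF inj])
    finally have "q = (\<Sum>x\<in>?F ` T. C x * x)" .
    moreover have "\<forall>x\<in>?F ` T. C x \<in> rat_invs G n (perm_rep \<phi>)"
      using T N_inv N_nz by (auto simp: C_def inv_into_f_f[OF inj] intro: Fract_in_rat_invs)
    ultimately show "q \<in> span_over (rat_invs G n (perm_rep \<phi>)) (?F ` polys_le n d)"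
      unfolding span_over_def using T by blast
  qed
qed

end

theorem theorem4p8:
  fixes G :: "('g, 'b) monoid_scheme"
    and n :: nat
    and \<phi> :: "'g \<Rightarrow> nat \<Rightarrow> nat"
    and R :: "'g \<Rightarrow> nat \<Rightarrow> nat \<Rightarrow> 'k::field"
  assumes "group G" and "finite (carrier G)"
    and "group_action G {1..n} \<phi>"
    and "R = perm_rep \<phi>"
  shows "D_span G n R \<le> topdeg G n R
    \<and> topdeg G n R \<le> (\<Sum>B\<in>orbits G {1..n} \<phi>. card B choose 2)
    \<and> (\<Sum>B\<in>orbits G {1..n} \<phi>. card B choose 2) \<le> n choose 2"
proof -
  interpret finite_perm_action G n \<phi>
    by (intro finite_perm_action.intro finite_perm_action_axioms.intro assms)
  have bound: "span_over (poly_invs G n R) (polys_le n goebel_bound) = polys n"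
    unfolding assms(4) by (rule low_span_eq_polys)
  \<comment> \<open>\<open>LEAST\<close> attains its property only if some degree has it;
    \<open>bound\<close> is that witness.\<close>
  then have "span_over (poly_invs G n R) (polys_le n (topdeg G n R)) = polys n"
    unfolding topdeg_def by (rule LeastI)
  then have "D_span G n R \<le> topdeg G n R"
    unfolding D_span_def assms(4) by (intro Least_le rat_span_eq_ratfuns)
  moreover have "topdeg G n R \<le> (\<Sum>B\<in>orbits G {1..n} \<phi>. card B choose 2)"
    using bound unfolding topdeg_def goebel_bound_def by (rule Least_le)
  moreover have "(\<Sum>B\<in>orbits G {1..n} \<phi>. card B choose 2) \<le> card (\<Union>(orbits G {1..n} \<phi>)) choose 2"
  proof (rule sum_card_choose_two_le)
    show "finite (orbits G {1..n} \<phi>)"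
      unfolding orbits_def by simp
    show "finite B" if "B \<in> orbits G {1..n} \<phi>" for B
      using that by (rule finite_orbit)
    show "pairwise disjnt (orbits G {1..n} \<phi>)"
      using disjoint_union by (auto simp: pairwise_def disjnt_def)
  qed
  \<comment> \<open>The orbits cover \<open>{1..n}\<close>, so the cardinality of their union is
    \<open>n\<close>.\<close>
  ultimately show ?thesis
    unfolding orbits_coverture by simp
qed

end
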